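(* Each of the following classes $\mathcal{C}$ of interpretable topological spaces (in $\mathbb{M}$) is closed under subspaces, i.e. whenever $X\in\mathcal{C}$ and $X'\subseteq X$ is an interpretable subset with the subspace topology, then $X'\in\mathcal{C}$: 1. the class of locally definable spaces; 2. the class of definably dominated spaces; 3. the class of admissible spaces.
   Context: Setting. Fix a prime $p$. A $p$-adically closed field is a field elementarily equivalent to $\mathbb{Q}_p$, and $p\mathrm{CF}$ is the theory of such fields. $\mathbb{M}$ is a monster model of $p\mathrm{CF}$ ($\kappa$-saturated and strongly $\kappa$-homogeneous for some large cardinal $\kappa$). "Definable" means a subset of some $\mathbb{M}^n$ definable with parameters. "Interpretable" means definable with parameters in $\mathbb{M}^{\mathrm{eq}}$; up to identification, interpretable sets are quotients $D/E$ with $D\subseteq\mathbb{M}^n$ definable and $E$ a definable equivalence relation on $D$. A map is interpretable if its graph is. Topology. $\mathbb{M}$ has the valuation topology, $\mathbb{M}^n$ the product topology, and definable subsets of $\mathbb{M}^n$ the subspace topology. A topology on an interpretable set $X$ is interpretable if it has a basis of the form $\{S_a : a\in I\}$ for some interpretable family $\{S_a\}_{a\in I}$; an interpretable topological space is an interpretable set with an interpretable topology. "Open map" always means continuous open map. The following notions are defined for Hausdorff interpretable topological spaces $X$ (so each includes being Hausdorff): - $X$ is locally definable if every point of $X$ has a neighborhood interpretably homeomorphic to a definable subspace of $\mathbb{M}^n$ for some $n$ depending on the point. - $X$ is definably dominated if there is an interpretable surjective open map $Y\to X$ for some definable set $Y\subseteq\mathbb{M}^n$ with the subspace topology. - $X$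 is admissible if it is definably dominated and locally definable. *)

theory Defs
  imports
    "HOL-Algebra.QuotRing"
    "HOL-Algebra.Subrings"
    "HOL-Computational_Algebra.Primes"
    "HOL-Analysis.T1_Spaces"
    "HOL-Analysis.Function_Topology"
begin

unbundle cardinal_syntax

section \<open>First-order logic in the language of rings\<close>

datatype rterm =
  RVar nat | RZero | ROne | RAdd rterm rterm | RMinus rterm | RMult rterm rterm

text \<open>Variables are de Bruijn indices: in \<open>FEx \<phi>\<close> the index 0 of \<open>\<phi>\<close> is bound.\<close>

datatype rform = FEq rterm rterm | FNeg rform | FConj rform rform | FEx rform

fun tvars :: "rterm \<Rightarrow> nat set" where
  "tvars (RVar i) = {i}"
| "tvars RZero = {}"
| "tvars ROne = {}"
| "tvars (RAdd s t) = tvars s \<union> tvars t"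
| "tvars (RMinus t) = tvars t"
| "tvars (RMult s t) = tvars s \<union> tvars t"

fun fvars :: "rform \<Rightarrow> nat set" where
  "fvars (FEq s t) = tvars s \<union> tvars t"
| "fvars (FNeg \<phi>) = fvars \<phi>"
| "fvars (FConj \<phi> \<psi>) = fvars \<phi> \<union> fvars \<psi>"
| "fvars (FEx \<phi>) = {i. Suc i \<in> fvars \<phi>}"

fun tval :: "('a, 'b) ring_scheme \<Rightarrow> (nat \<Rightarrow> 'a) \<Rightarrow> rterm \<Rightarrow> 'a" where
  "tval M e (RVar i) = e i"
| "tval M e RZero = \<zero>\<^bsub>M\<^esub>"
| "tval M e ROne = \<one>\<^bsub>M\<^esub>"
| "tval M e (RAdd s t) = tval M e s \<oplus>\<^bsub>M\<^esub> tval M e t"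
| "tval M e (RMinus t) = \<ominus>\<^bsub>M\<^esub> tval M e t"
| "tval M e (RMult s t) = tval M e s \<otimes>\<^bsub>M\<^esub> tval M e t"

fun sat :: "('a, 'b) ring_scheme \<Rightarrow> (nat \<Rightarrow> 'a) \<Rightarrow> rform \<Rightarrow> bool" where
  "sat M e (FEq s t) \<longleftrightarrow> tval M e s = tval M e t"
| "sat M e (FNeg \<phi>) \<longleftrightarrow> \<not> sat M e \<phi>"
| "sat M e (FConj \<phi> \<psi>) \<longleftrightarrow> sat M e \<phi> \<and> sat M e \<psi>"
| "sat M e (FEx \<phi>) \<longleftrightarrow> (\<exists>a\<in>carrier M. sat M (case_nat a e) \<phi>)"

definition elem_equiv :: "('a, 'm) ring_scheme \<Rightarrow> ('b, 'n) ring_scheme \<Rightarrow> bool" where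
  "elem_equiv M N \<longleftrightarrow> (\<forall>\<phi>. fvars \<phi> = {} \<longrightarrow> (\<forall>e e'. sat M e \<phi> \<longleftrightarrow> sat N e' \<phi>))"


section \<open>The field of \<open>p\<close>-adic numbers\<close>

text \<open>\<open>\<rat>\<^sub>p\<close> is the completion of \<open>\<rat>\<close> at the \<open>p\<close>-adic absolute value: Cauchy sequences of
  rationals modulo null sequences.\<close>

definition padic_abs :: "nat \<Rightarrow> rat \<Rightarrow> rat" where
  "padic_abs p x = (if x = 0 then 0 else
     (let (a, b) = quotient_of x
      in of_nat p powi (int (multiplicity (int p) b) - int (multiplicity (int p) a))))"

definition padic_cauchy :: "nat \<Rightarrow> (nat \<Rightarrow> rat) \<Rightarrow> bool" where
  "padic_cauchy p s \<longleftrightarrow> (\<forall>\<epsilon>>0. \<exists>N. \<forall>m\<ge>N. \<forall>n\<ge>N. padic_abs p (s m - s n) < \<epsilon>)"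

definition padic_null :: "nat \<Rightarrow> (nat \<Rightarrow> rat) \<Rightarrow> bool" where
  "padic_null p s \<longleftrightarrow> (\<forall>\<epsilon>>0. \<exists>N. \<forall>n\<ge>N. padic_abs p (s n) < \<epsilon>)"

definition padic_cauchy_ring :: "nat \<Rightarrow> (nat \<Rightarrow> rat) ring" where
  "padic_cauchy_ring p =
     \<lparr>carrier = {s. padic_cauchy p s}, monoid.mult = (\<lambda>s t n. s n * t n), one = (\<lambda>_. 1),
      zero = (\<lambda>_. 0), add = (\<lambda>s t n. s n + t n)\<rparr>"

definition Qp :: "nat \<Rightarrow> (nat \<Rightarrow> rat) set ring" where
  "Qp p = padic_cauchy_ring p Quot {s. padic_null p s}"

definition padically_closed :: "nat \<Rightarrow> ('a, 'm) ring_scheme \<Rightarrow> bool" where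
  "padically_closed p M \<longleftrightarrow> field M \<and> elem_equiv M (Qp p)"


section \<open>Monster models\<close>

text \<open>A formula over \<open>A\<close> in one variable is a pair \<open>(\<phi>, e)\<close>: the free index 0 of \<open>\<phi>\<close> is the
  variable, and \<open>e\<close> supplies the parameter for each other free index (shifted by one).\<close>

definition formulas_over :: "'a set \<Rightarrow> (rform \<times> (nat \<Rightarrow> 'a)) set" where
  "formulas_over A = {(\<phi>, e). \<forall>i. Suc i \<in> fvars \<phi> \<longrightarrow> e i \<in> A}"

definition realized :: "('a, 'm) ring_scheme \<Rightarrow> (rform \<times> (nat \<Rightarrow> 'a)) set \<Rightarrow> bool" where
  "realized M \<Sigma> \<longleftrightarrow> (\<exists>b\<in>carrier M. \<forall>(\<phi>, e)\<in>\<Sigma>. sat M (case_nat b e) \<phi>)"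

definition saturated :: "('a, 'm) ring_scheme \<Rightarrow> 'k rel \<Rightarrow> bool" where
  "saturated M \<kappa> \<longleftrightarrow>
     (\<forall>A \<Sigma>. A \<subseteq> carrier M \<and> |A| <o \<kappa> \<and> \<Sigma> \<subseteq> formulas_over A \<and>
        (\<forall>\<Sigma>\<^sub>0. finite \<Sigma>\<^sub>0 \<and> \<Sigma>\<^sub>0 \<subseteq> \<Sigma> \<longrightarrow> realized M \<Sigma>\<^sub>0) \<longrightarrow> realized M \<Sigma>)"

definition partial_elementary :: "('a, 'm) ring_scheme \<Rightarrow> 'a set \<Rightarrow> ('a \<Rightarrow> 'a) \<Rightarrow> bool" where
  "partial_elementary M A f \<longleftrightarrow>
     A \<subseteq> carrier M \<and> f ` A \<subseteq> carrier M \<and>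
     (\<forall>\<phi> e. e ` fvars \<phi> \<subseteq> A \<longrightarrow> (sat M e \<phi> \<longleftrightarrow> sat M (f \<circ> e) \<phi>))"

definition strongly_homogeneous :: "('a, 'm) ring_scheme \<Rightarrow> 'k rel \<Rightarrow> bool" where
  "strongly_homogeneous M \<kappa> \<longleftrightarrow>
     (\<forall>A f. partial_elementary M A f \<and> |A| <o \<kappa> \<longrightarrow>
        (\<exists>\<sigma>\<in>ring_iso M M. \<forall>a\<in>A. \<sigma> a = f a))"

text \<open>Of the ``large'' cardinal \<open>\<kappa>\<close> only uncountability (so that \<open>\<kappa>\<close> exceeds the size of the
  language) is imposed.\<close>

definition monster_model :: "nat \<Rightarrow> ('a, 'm) ring_scheme \<Rightarrow> 'k rel \<Rightarrow> bool" where
  "monster_model p M \<kappa> \<longleftrightarrow>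
     padically_closed p M \<and> Card_order \<kappa> \<and> natLeq <o \<kappa> \<and>
     saturated M \<kappa> \<and> strongly_homogeneous M \<kappa>"


section \<open>The valuation topology\<close>

definition valuation_ring :: "('a, 'm) ring_scheme \<Rightarrow> 'a set \<Rightarrow> bool" where
  "valuation_ring M \<O> \<longleftrightarrow>
     subring \<O> M \<and> (\<forall>x\<in>carrier M - {\<zero>\<^bsub>M\<^esub>}. x \<in> \<O> \<or> inv\<^bsub>M\<^esub> x \<in> \<O>)"

text \<open>The valuation on a \<open>p\<close>-adically closed field is its \<open>p\<close>-valuation of \<open>p\<close>-rank one, i.e. the
  one whose valuation ring satisfies \<open>\<O>/p\<O> = \<bbbF>\<^sub>p\<close>.  A \<open>p\<close>-adically closed field has exactly one
  such valuation ring (it is defined by \<open>\<exists>y. y\<^sup>2 = 1 + p\<^sup>3x\<^sup>4\<close>), so the parameter \<open>\<O>\<close> below is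
  determined by the field.\<close>

definition p_valuation_ring :: "nat \<Rightarrow> ('a, 'm) ring_scheme \<Rightarrow> 'a set \<Rightarrow> bool" where
  "p_valuation_ring p M \<O> \<longleftrightarrow>
     valuation_ring M \<O> \<and>
     (let R = M\<lparr>carrier := \<O>\<rparr> in card (carrier (R Quot (PIdl\<^bsub>R\<^esub> ([p] \<cdot>\<^bsub>M\<^esub> \<one>\<^bsub>M\<^esub>)))) = p)"

text \<open>The ball \<open>a + c\<O> = {x. v (x - a) \<ge> v c}\<close>.\<close>

definition vball :: "('a, 'm) ring_scheme \<Rightarrow> 'a set \<Rightarrow> 'a \<Rightarrow> 'a \<Rightarrow> 'a set" where
  "vball M \<O> a c = {a \<oplus>\<^bsub>M\<^esub> c \<otimes>\<^bsub>M\<^esub> r | r. r \<in> \<O>}"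

definition valuation_topology :: "('a, 'm) ring_scheme \<Rightarrow> 'a set \<Rightarrow> 'a topology" where
  "valuation_topology M \<O> =
     topology_generated_by {vball M \<O> a c | a c. a \<in> carrier M \<and> c \<in> carrier M - {\<zero>\<^bsub>M\<^esub>}}"


section \<open>Definable and interpretable sets\<close>

text \<open>\<open>M\<^sup>n\<close> consists of the extensional functions on \<open>{..<n}\<close>.\<close>

type_synonym 'a tuple = "nat \<Rightarrow> 'a"

definition tuples :: "('a, 'm) ring_scheme \<Rightarrow> nat \<Rightarrow> 'a tuple set" where
  "tuples M n = {..<n} \<rightarrow>\<^sub>E carrier M"

definition tuples_topology :: "('a, 'm) ring_scheme \<Rightarrow> 'a set \<Rightarrow> nat \<Rightarrow> 'a tuple topology" where
  "tuples_topology M \<O> n = product_topology (\<lambda>_. valuation_topology M \<O>) {..<n}"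

text \<open>Concatenation; for \<open>x \<in> M\<^sup>m\<close> and \<open>y \<in> M\<^sup>n\<close> it identifies \<open>M\<^sup>m \<times> M\<^sup>n\<close> with \<open>M\<^bsup>m+n\<^esup>\<close>.\<close>

definition tcat :: "nat \<Rightarrow> 'a tuple \<Rightarrow> (nat \<Rightarrow> 'a) \<Rightarrow> nat \<Rightarrow> 'a" where
  "tcat m x y = (\<lambda>i. if i < m then x i else y (i - m))"

text \<open>Definable with parameters: the parameters are the \<open>c i\<close>.\<close>

definition definable :: "('a, 'm) ring_scheme \<Rightarrow> nat \<Rightarrow> 'a tuple set \<Rightarrow> bool" where
  "definable M n D \<longleftrightarrow>
     (\<exists>\<phi> c. (\<forall>i. c i \<in> carrier M) \<and> D = {x \<in> tuples M n. sat M (tcat n x c) \<phi>})"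

text \<open>An interpretable set is a quotient \<open>D // E\<close>, a set of equivalence classes of \<open>n\<close>-tuples.
  The number \<open>n\<close> is an explicit argument, as it cannot be read off from \<open>X\<close> in general.\<close>

definition interpretable :: "('a, 'm) ring_scheme \<Rightarrow> nat \<Rightarrow> 'a tuple set set \<Rightarrow> bool" where
  "interpretable M n X \<longleftrightarrow>
     (\<exists>D E. definable M n D \<and> equiv D E \<and> definable M (n + n) {tcat n x y | x y. (x, y) \<in> E} \<and>
        X = D // E)"

text \<open>A relation between \<open>X = D // E\<close> and \<open>X' = D' // E'\<close> is interpretable iff its preimage in
  \<open>D \<times> D'\<close> is definable.  A definable set \<open>D\<close> is regarded as the interpretable set
  \<open>D // Id_on D\<close>, i.e. its points \<open>x\<close> appear as the singletons \<open>{x}\<close> here.\<close>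

definition interpretable_rel ::
  "('a, 'm) ring_scheme \<Rightarrow> nat \<Rightarrow> nat \<Rightarrow> ('a tuple set \<times> 'a tuple set) set \<Rightarrow> bool" where
  "interpretable_rel M m n R \<longleftrightarrow>
     definable M (m + n) {tcat m x y | x y A B. (A, B) \<in> R \<and> x \<in> A \<and> y \<in> B}"

definition interpretable_family ::
  "('a, 'm) ring_scheme \<Rightarrow> nat \<Rightarrow> 'a tuple set set \<Rightarrow> nat \<Rightarrow> 'a tuple set set \<Rightarrow>
     ('a tuple set \<Rightarrow> 'a tuple set set) \<Rightarrow> bool" where
  "interpretable_family M k I n X S \<longleftrightarrow>
     interpretable M k I \<and> (\<forall>a\<in>I. S a \<subseteq> X) \<and>
     interpretable_rel M k n {(a, x). a \<in> I \<and> x \<in> S a}"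


section \<open>Interpretable topological spaces\<close>

definition interpretable_space ::
  "('a, 'm) ring_scheme \<Rightarrow> nat \<Rightarrow> 'a tuple set topology \<Rightarrow> bool" where
  "interpretable_space M n X \<longleftrightarrow>
     interpretable M n (topspace X) \<and>
     (\<exists>k I S. interpretable_family M k I n (topspace X) S \<and>
        (\<forall>a\<in>I. openin X (S a)) \<and>
        (\<forall>U x. openin X U \<and> x \<in> U \<longrightarrow> (\<exists>a\<in>I. x \<in> S a \<and> S a \<subseteq> U)))"

definition locally_definable ::
  "('a, 'm) ring_scheme \<Rightarrow> 'a set \<Rightarrow> nat \<Rightarrow> 'a tuple set topology \<Rightarrow> bool" where
  "locally_definable M \<O> n X \<longleftrightarrow>
     interpretable_space M n X \<and> Hausdorff_space X \<and>
     (\<forall>x\<in>topspace X. \<exists>N U. openin X U \<and> x \<in> U \<and> U \<subseteq> N \<and> N \<subseteq> topspace X \<and>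
        interpretable M n N \<and>
        (\<exists>k D f. definable M k D \<and>
           homeomorphic_map (subtopology X N) (subtopology (tuples_topology M \<O> k) D) f \<and>
           interpretable_rel M n k {(y, {f y}) | y. y \<in> N}))"

definition definably_dominated ::
  "('a, 'm) ring_scheme \<Rightarrow> 'a set \<Rightarrow> nat \<Rightarrow> 'a tuple set topology \<Rightarrow> bool" where
  "definably_dominated M \<O> n X \<longleftrightarrow>
     interpretable_space M n X \<and> Hausdorff_space X \<and>
     (\<exists>k Y g. definable M k Y \<and>
        continuous_map (subtopology (tuples_topology M \<O> k) Y) X g \<and>
        open_map (subtopology (tuples_topology M \<O> k) Y) X g \<and>
        g ` Y = topspace X \<and>
        interpretable_rel M k n {({y}, g y) | y. y \<in> Y})"

definition admissible ::
  "('a, 'm) ring_scheme \<Rightarrow> 'a set \<Rightarrow> nat \<Rightarrow> 'a tuple set topology \<Rightarrow> bool" where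
  "admissible M \<O> n X \<longleftrightarrow> definably_dominated M \<O> n X \<and> locally_definable M \<O> n X"

definition closed_under_subspaces ::
  "('a, 'm) ring_scheme \<Rightarrow> (nat \<Rightarrow> 'a tuple set topology \<Rightarrow> bool) \<Rightarrow> bool" where
  "closed_under_subspaces M \<C> \<longleftrightarrow>
     (\<forall>n X X'. \<C> n X \<and> X' \<subseteq> topspace X \<and> interpretable M n X' \<longrightarrow> \<C> n (subtopology X X'))"

end

theory Submission
  imports Defs
begin

text \<open>For an open surjection \<open>g\<close> from a definable \<open>Y\<close> onto \<open>X\<close>, restrict \<open>g\<close> to the definable
  set \<open>g\<^sup>-\<^sup>1(X')\<close>: the restriction of an open map to a full preimage is again open.  For a chart
  \<open>f\<close> on a neighbourhood \<open>N\<close>, restrict \<open>f\<close> to \<open>N \<inter> X'\<close>, whose image is definable.  All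
  definability questions reduce to closure of definable sets under intersections, substitution of
  coordinates, and projections.\<close>

section \<open>Renaming and block quantification\<close>

fun tren :: "(nat \<Rightarrow> nat) \<Rightarrow> rterm \<Rightarrow> rterm" where
  "tren f (RVar i) = RVar (f i)"
| "tren f RZero = RZero"
| "tren f ROne = ROne"
| "tren f (RAdd s t) = RAdd (tren f s) (tren f t)"
| "tren f (RMinus t) = RMinus (tren f t)"
| "tren f (RMult s t) = RMult (tren f s) (tren f t)"

text \<open>Under \<open>FEx\<close> the bound index 0 stays fixed and \<open>f\<close> acts on the
  shifted indices. The lifted map sends no free index to 0, so nothing is captured, even when
  \<open>f\<close> is not injective.\<close>

fun fren :: "(nat \<Rightarrow> nat) \<Rightarrow> rform \<Rightarrow> rform" where
  "fren f (FEq s t) = FEq (tren f s) (tren f t)"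
| "fren f (FNeg \<phi>) = FNeg (fren f \<phi>)"
| "fren f (FConj \<phi> \<psi>) = FConj (fren f \<phi>) (fren f \<psi>)"
| "fren f (FEx \<phi>) = FEx (fren (case_nat 0 (Suc \<circ> f)) \<phi>)"

lemma tval_tren: "tval M e (tren f t) = tval M (e \<circ> f) t"
  by (induction t) auto

lemma sat_fren: "sat M e (fren f \<phi>) \<longleftrightarrow> sat M (e \<circ> f) \<phi>"
proof (induction \<phi> arbitrary: e f)
  case (FEx \<phi>)
  \<comment> \<open>Lifting the renaming matches pushing a value onto the environment, so the
    induction hypothesis, general in \<open>e\<close> and \<open>f\<close>, applies under the
    quantifier.\<close>
  have "case_nat a e \<circ> case_nat 0 (Suc \<circ> f) = case_nat a (e \<circ> f)" for a
    by (rule ext) (simp split: nat.split)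
  then show ?case by (simp only: fren.simps sat.simps FEx)
qed (auto simp: tval_tren)

lemma sat_FEx_funpow:
  "sat M e ((FEx ^^ m) \<phi>) \<longleftrightarrow> (\<exists>v\<in>tuples M m. sat M (tcat m v e) \<phi>)"
proof (induction m arbitrary: e)
  case 0
  then show ?case by (simp add: tuples_def tcat_def)
next
  case (Suc m)
  have tuples_Suc: "tuples M (Suc m) = (\<lambda>(a, v). v(m := a)) ` (carrier M \<times> tuples M m)"
    by (simp add: tuples_def lessThan_Suc PiE_insert_eq)
  \<comment> \<open>The outermost of the \<open>Suc m\<close> quantifiers binds index
    \<open>m\<close> of \<open>\<phi>\<close>, so its witness becomes the last coordinate of the
    tuple.\<close>
  have "tcat m v (case_nat a e) = tcat (Suc m) (v(m := a)) e" for a v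
  proof
    fix i
    consider "i < m" | "i = m" | "i > m" by linarith
    then show "tcat m v (case_nat a e) i = tcat (Suc m) (v(m := a)) e i"
      by cases (auto simp: tcat_def split: nat.split intro!: arg_cong[of _ _ e])
  qed
  then show ?case by (auto simp: tuples_Suc Suc)
qed


section \<open>Definable sets\<close>

lemma tcat_assoc: "tcat (m + n) (tcat m v w) c = tcat m v (tcat n w c)"
  by (rule ext) (auto simp: tcat_def)

lemma tcat_in_tuples:
  "v \<in> tuples M m \<Longrightarrow> w \<in> tuples M n \<Longrightarrow> tcat m v w \<in> tuples M (m + n)"
  by (auto simp: tuples_def tcat_def PiE_iff extensional_def)

text \<open>Concatenation drops the values of \<open>v\<close> from index \<open>m\<close> on, and
  extensionality of tuples fixes those to \<open>undefined\<close>. The second block is read off in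
  full from the indices at and above \<open>m\<close>.\<close>

lemma tcat_eq_iff:
  assumes "v \<in> tuples M m" "v' \<in> tuples M m"
  shows "tcat m v w = tcat m v' w' \<longleftrightarrow> v = v' \<and> w = w'"
proof
  assume eq: "tcat m v w = tcat m v' w'"
  have "v i = v' i" for i
    using fun_cong[OF eq, of i] assms
    by (cases "i < m") (auto simp: tcat_def tuples_def PiE_iff extensional_def)
  moreover have "w i = w' i" for i
    using fun_cong[OF eq, of "i + m"] by (simp add: tcat_def)
  ultimately show "v = v' \<and> w = w'" by blast
qed simp

lemma definable_subset_tuples: "definable M n D \<Longrightarrow> D \<subseteq> tuples M n"
  by (auto simp: definable_def)

text \<open>Each formula brings its own infinite parameter sequence. Interleaving them,
  \<open>c\<close> at even and \<open>d\<close> at odd positions, gives one sequence;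
  \<open>f\<close> and \<open>g\<close> rename the parameters of the two formulas accordingly and
  fix the first \<open>n\<close> variables.\<close>

lemma definable_Int:
  assumes "definable M n A" "definable M n B"
  shows "definable M n (A \<inter> B)"
proof -
  obtain \<phi> c where c: "\<And>i. c i \<in> carrier M" and A: "A = {x \<in> tuples M n. sat M (tcat n x c) \<phi>}"
    using assms(1) by (auto simp: definable_def)
  obtain \<psi> d where d: "\<And>i. d i \<in> carrier M" and B: "B = {x \<in> tuples M n. sat M (tcat n x d) \<psi>}"
    using assms(2) by (auto simp: definable_def)
  define e where "e i = (if even i then c (i div 2) else d (i div 2))" for i
  define f where "f i = (if i < n then i else n + 2 * (i - n))" for i
  define g where "g i = (if i < n then i else n + (2 * (i - n) + 1))" for i
  have "tcat n x e \<circ> f = tcat n x c" "tcat n x e \<circ> g = tcat n x d" for x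
    by (auto simp: fun_eq_iff tcat_def e_def f_def g_def)
  then have "A \<inter> B = {x \<in> tuples M n. sat M (tcat n x e) (FConj (fren f \<phi>) (fren g \<psi>))}"
    by (auto simp: A B sat_fren)
  moreover have "\<forall>i. e i \<in> carrier M"
    by (simp add: e_def c d)
  ultimately show ?thesis
    unfolding definable_def by blast
qed

text \<open>Substituting coordinates is renaming variables along \<open>f\<close>; the parameters,
  which start at index \<open>m\<close>, move to start at \<open>n\<close>. As \<open>f\<close> is
  arbitrary, this covers cylinders as well as permutations of coordinates.\<close>

lemma definable_comap:
  assumes "definable M m D" and f: "\<And>i. i < m \<Longrightarrow> f i < n"
  shows "definable M n {x \<in> tuples M n. restrict (x \<circ> f) {..<m} \<in> D}"
proof -
  obtain \<phi> c where c: "\<forall>i. c i \<in> carrier M" and D: "D = {x \<in> tuples M m. sat M (tcat m x c) \<phi>}"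
    using assms(1) by (auto simp: definable_def)
  define g where "g i = (if i < m then f i else n + (i - m))" for i
  have "tcat n x c \<circ> g = tcat m (restrict (x \<circ> f) {..<m}) c" for x
    by (auto simp: fun_eq_iff tcat_def g_def f)
  moreover have "restrict (x \<circ> f) {..<m} \<in> tuples M m" if "x \<in> tuples M n" for x
    using that f by (auto simp: tuples_def PiE_iff)
  ultimately have "{x \<in> tuples M n. restrict (x \<circ> f) {..<m} \<in> D} =
      {x \<in> tuples M n. sat M (tcat n x c) (fren g \<phi>)}"
    by (auto simp: D sat_fren)
  with c show ?thesis
    unfolding definable_def by blast
qed

text \<open>Definability demands a parameter sequence in the carrier; the given definable set
  supplies one.\<close>

lemma definable_tuples:
  fixes M :: "('a, 'm) ring_scheme"
  assumes "definable M m D"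
  shows "definable M n (tuples M n)"
proof -
  obtain c :: "nat \<Rightarrow> 'a" where c: "\<forall>i. c i \<in> carrier M"
    using assms by (auto simp: definable_def)
  have "tuples M n = {x \<in> tuples M n. sat M (tcat n x c) (FEq RZero RZero)}"
    by simp
  with c show ?thesis
    unfolding definable_def by blast
qed

section \<open>Products and projections of definable sets\<close>

lemma tuples_add_cases:
  assumes "x \<in> tuples M (m + n)"
  obtains v w where "v \<in> tuples M m" "w \<in> tuples M n" "x = tcat m v w"
proof
  show "restrict x {..<m} \<in> tuples M m" "(\<lambda>i. x (m + i)) \<in> tuples M n"
    "x = tcat m (restrict x {..<m}) (\<lambda>i. x (m + i))"
    using assms by (auto simp: tuples_def PiE_iff extensional_def tcat_def fun_eq_iff)
qed

text \<open>The identity reindexing is written out so that the term has the shape produced by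
  \<open>definable_comap\<close>.\<close>

lemma restrict_tcat_left:
  "v \<in> tuples M m \<Longrightarrow> restrict (tcat m v w \<circ> (\<lambda>i. i)) {..<m} = v"
  by (auto simp: fun_eq_iff tcat_def tuples_def PiE_iff extensional_def)

lemma restrict_tcat_right:
  "w \<in> tuples M n \<Longrightarrow> restrict (tcat m v w \<circ> (\<lambda>i. m + i)) {..<n} = w"
  by (auto simp: fun_eq_iff tcat_def tuples_def PiE_iff extensional_def)

text \<open>A product is the intersection of two cylinders, each a preimage under a selection of
  coordinates.\<close>

lemma definable_Times:
  assumes "definable M m A" "definable M n B"
  shows "definable M (m + n) {tcat m v w | v w. v \<in> A \<and> w \<in> B}"
proof -
  note AB = definable_subset_tuples[OF assms(1)] definable_subset_tuples[OF assms(2)]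
  have "{tcat m v w | v w. v \<in> A \<and> w \<in> B} =
      {x \<in> tuples M (m + n). restrict (x \<circ> (\<lambda>i. i)) {..<m} \<in> A} \<inter>
      {x \<in> tuples M (m + n). restrict (x \<circ> (\<lambda>i. m + i)) {..<n} \<in> B}" (is "?L = ?R")
  proof (intro equalityI subsetI)
    fix x assume "x \<in> ?L"
    then obtain v w where x: "x = tcat m v w" and vw: "v \<in> A" "w \<in> B" by auto
    then have "v \<in> tuples M m" "w \<in> tuples M n" using AB by auto
    then show "x \<in> ?R"
      using vw unfolding x by (simp only: Int_iff mem_Collect_eq tcat_in_tuples
          restrict_tcat_left restrict_tcat_right simp_thms)
  next
    fix x assume x: "x \<in> ?R"
    then have "x \<in> tuples M (m + n)" by simp
    then obtain v w where vw: "v \<in> tuples M m" "w \<in> tuples M n" "x = tcat m v w"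
      by (rule tuples_add_cases)
    with x have "v \<in> A" "w \<in> B"
      by (simp_all only: Int_iff mem_Collect_eq restrict_tcat_left restrict_tcat_right)
    then show "x \<in> ?L" using vw by blast
  qed
  moreover have "definable M (m + n) \<dots>"
    by (intro definable_Int definable_comap assms) auto
  ultimately show ?thesis by simp
qed

text \<open>A block of \<open>m\<close> quantifiers binds exactly the indices below
  \<open>m\<close>, the first block of coordinates; the other variables and the parameters then
  shift down into place.\<close>

lemma definable_projection_right:
  assumes "definable M (m + n) R"
  shows "definable M n {w \<in> tuples M n. \<exists>v\<in>tuples M m. tcat m v w \<in> R}"
proof -
  obtain \<phi> c where c: "\<forall>i. c i \<in> carrier M"
    and R: "R = {x \<in> tuples M (m + n). sat M (tcat (m + n) x c) \<phi>}"
    using assms by (auto simp: definable_def)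
  have "{w \<in> tuples M n. \<exists>v\<in>tuples M m. tcat m v w \<in> R} =
      {w \<in> tuples M n. sat M (tcat n w c) ((FEx ^^ m) \<phi>)}"
    by (auto simp: R sat_FEx_funpow tcat_assoc tcat_in_tuples)
  with c show ?thesis
    unfolding definable_def by blast
qed

lemma definable_projection_left:
  assumes "definable M (m + n) R"
  shows "definable M m {v \<in> tuples M m. \<exists>w\<in>tuples M n. tcat m v w \<in> R}"
proof -
  \<comment> \<open>Reindexing along \<open>f\<close> swaps the two blocks, which reduces the claim
    to quantifying over the first block.\<close>
  define f where "f i = (if i < m then n + i else i - m)" for i
  have "restrict (tcat n w v \<circ> f) {..<m + n} = tcat m v w"
    if "v \<in> tuples M m" "w \<in> tuples M n" for v w
    using that by (auto simp: fun_eq_iff tcat_def f_def tuples_def PiE_iff extensional_def)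
  then have "{v \<in> tuples M m. \<exists>w\<in>tuples M n. tcat m v w \<in> R} =
      {v \<in> tuples M m. \<exists>w\<in>tuples M n. tcat n w v \<in>
        {x \<in> tuples M (n + m). restrict (x \<circ> f) {..<m + n} \<in> R}}"
    by (auto simp: tcat_in_tuples)
  moreover have "definable M m \<dots>"
    by (intro definable_projection_right definable_comap assms) (auto simp: f_def)
  ultimately show ?thesis by simp
qed


section \<open>Interpretable sets and relations\<close>

text \<open>Equivalence relations and partitions determine each other: \<open>D\<close> is recovered
  as \<open>\<Union>X\<close> and \<open>E\<close> as lying in a common class. The quotient can thus
  be handled through \<open>X\<close> alone, without choosing \<open>D\<close> and
  \<open>E\<close>.\<close>

lemma interpretable_iff:
  "interpretable M n X \<longleftrightarrow> definable M n (\<Union>X) \<and> disjoint X \<and> {} \<notin> X \<and>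
     definable M (n + n) {tcat n x y | x y. \<exists>A\<in>X. x \<in> A \<and> y \<in> A}"
proof
  assume "interpretable M n X"
  then obtain D E where D: "definable M n D" and E: "equiv D E"
    and DE: "definable M (n + n) {tcat n x y | x y. (x, y) \<in> E}" and X: "X = D // E"
    by (auto simp: interpretable_def)
  have "partition_on D X"
    unfolding X using E by (rule partition_on_quotient)
  then have p: "\<Union>X = D" "disjoint X" "{} \<notin> X"
    by (auto simp: partition_on_def)
  have "(x, y) \<in> E \<longleftrightarrow> (\<exists>A\<in>X. x \<in> A \<and> y \<in> A)" for x y
  proof
    assume xy: "(x, y) \<in> E"
    then have "x \<in> D" using E by (auto simp: equiv_def refl_on_def)
    then have "E `` {x} \<in> X" "x \<in> E `` {x}"
      unfolding X by (rule quotientI) (rule equiv_class_self[OF E \<open>x \<in> D\<close>])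
    with xy show "\<exists>A\<in>X. x \<in> A \<and> y \<in> A" by auto
  next
    assume "\<exists>A\<in>X. x \<in> A \<and> y \<in> A"
    then show "(x, y) \<in> E"
      unfolding X using quotient_eq_iff[OF E] by blast
  qed
  with DE D p show "definable M n (\<Union>X) \<and> disjoint X \<and> {} \<notin> X \<and>
     definable M (n + n) {tcat n x y | x y. \<exists>A\<in>X. x \<in> A \<and> y \<in> A}" by simp
next
  assume X: "definable M n (\<Union>X) \<and> disjoint X \<and> {} \<notin> X \<and>
     definable M (n + n) {tcat n x y | x y. \<exists>A\<in>X. x \<in> A \<and> y \<in> A}"
  define E where "E = {(x, y). \<exists>A\<in>X. x \<in> A \<and> y \<in> A}"
  from X have p: "partition_on (\<Union>X) X" by (simp add: partition_on_def)
  have "equiv (\<Union>X) E" "X = \<Union>X // E"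
    unfolding E_def using equiv_partition_on[OF p] partition_on_eq_quotient[OF p] by simp_all
  with X show "interpretable M n X"
    unfolding interpretable_def by (intro exI[of _ "\<Union>X"] exI[of _ E]) (simp add: E_def)
qed

lemma interpretable_Union_subset: "interpretable M n X \<Longrightarrow> \<Union>X \<subseteq> tuples M n"
  by (simp add: interpretable_iff definable_subset_tuples)

text \<open>Disjointness of the ambient family \<open>X\<close> makes each class determined by any of its points.\<close>

lemma disjoint_same_class:
  "disjoint X \<Longrightarrow> A \<in> X \<Longrightarrow> B \<in> X \<Longrightarrow> x \<in> A \<Longrightarrow> x \<in> B \<Longrightarrow> A = B"
  by (auto simp: disjoint_def)

text \<open>Inside one disjoint family, classes with a common point coincide, so intersecting sets
  of classes agrees with intersecting their unions and their same-class relations.\<close>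

lemma interpretable_Int:
  assumes "interpretable M n A" "interpretable M n B"
    and X: "disjoint X" "A \<subseteq> X" "B \<subseteq> X"
  shows "interpretable M n (A \<inter> B)"
proof -
  note same = disjoint_same_class[OF X(1)]
  have "\<Union>(A \<inter> B) = \<Union>A \<inter> \<Union>B"
    using X(2,3) same by blast
  moreover have "{tcat n x y | x y. \<exists>C\<in>A \<inter> B. x \<in> C \<and> y \<in> C} =
      {tcat n x y | x y. \<exists>C\<in>A. x \<in> C \<and> y \<in> C} \<inter> {tcat n x y | x y. \<exists>C\<in>B. x \<in> C \<and> y \<in> C}"
    (is "?L = ?R")
  proof (intro equalityI subsetI)
    fix z assume "z \<in> ?R"
    then obtain x y C x' y' C' where z: "z = tcat n x y" "z = tcat n x' y'"
      and C: "C \<in> A" "x \<in> C" "y \<in> C" and C': "C' \<in> B" "x' \<in> C'" "y' \<in> C'"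
      by blast
    \<comment> \<open>The two decompositions of \<open>z\<close> may be compared, since classes
      consist of \<open>n\<close>-tuples; the shared point \<open>x\<close> then forces
      \<open>C = C'\<close>.\<close>
    have "x \<in> tuples M n" "x' \<in> tuples M n"
      using C C' assms(1,2)[THEN interpretable_Union_subset] by auto
    then have "x = x'"
      using z tcat_eq_iff by metis
    then have "C = C'"
      using same[of C C' x] C C' X by auto
    then show "z \<in> ?L"
      using z C C' by blast
  qed blast
  moreover have "disjoint (A \<inter> B)"
    using X by (auto simp: disjoint_def)
  ultimately show ?thesis
    using assms(1,2) by (simp add: interpretable_iff definable_Int)
qed

text \<open>On representatives the restriction is an intersection with the product of
  \<open>\<Union>A\<close> and \<open>\<Union>B\<close>: by disjointness, a class in
  \<open>X\<close> meeting \<open>\<Union>A\<close> already belongs to \<open>A\<close>, and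
  likewise for \<open>Y\<close> and \<open>B\<close>. This serves to cut down both families and
  graphs of maps.\<close>

lemma interpretable_rel_Int_Times:
  assumes R: "interpretable_rel M m n R" "R \<subseteq> X \<times> Y"
    and X: "disjoint X" "\<Union>X \<subseteq> tuples M m" "A \<subseteq> X" "definable M m (\<Union>A)"
    and Y: "disjoint Y" "B \<subseteq> Y" "definable M n (\<Union>B)"
  shows "interpretable_rel M m n (R \<inter> A \<times> B)"
proof -
  have "{tcat m x y | x y C D. (C, D) \<in> R \<inter> A \<times> B \<and> x \<in> C \<and> y \<in> D} =
      {tcat m x y | x y C D. (C, D) \<in> R \<and> x \<in> C \<and> y \<in> D} \<inter>
      {tcat m x y | x y. x \<in> \<Union>A \<and> y \<in> \<Union>B}" (is "?L = ?R")
  proof (intro equalityI subsetI)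
    fix z assume "z \<in> ?R"
    then obtain x y C D x' y' where z: "z = tcat m x y" "z = tcat m x' y'"
      and CD: "(C, D) \<in> R" "x \<in> C" "y \<in> D" and AB: "x' \<in> \<Union>A" "y' \<in> \<Union>B"
      by blast
    have "x \<in> tuples M m" "x' \<in> tuples M m"
      using CD AB R(2) X(2,3) by auto
    then have xy: "x' = x" "y' = y"
      using z tcat_eq_iff by metis+
    have "C \<in> X" "D \<in> Y"
      using CD(1) R(2) by auto
    then have "C \<in> A" "D \<in> B"
      using AB CD X(3) Y(2) disjoint_same_class[OF X(1)] disjoint_same_class[OF Y(1)]
      unfolding xy by blast+
    then show "z \<in> ?L"
      using z CD by blast
  qed blast
  then show ?thesis
    using R(1) definable_Int[OF _ definable_Times[OF X(4) Y(3)]]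
    by (simp add: interpretable_rel_def)
qed

text \<open>Both sets are projections of the definable set of representatives. Nonempty classes on
  the side projected away ensure that every related class on the other side is reached.\<close>

lemma
  assumes R: "interpretable_rel M m n R" "R \<subseteq> X \<times> Y"
    and XY: "\<Union>X \<subseteq> tuples M m" "\<Union>Y \<subseteq> tuples M n"
  shows definable_Union_Range: "{} \<notin> X \<Longrightarrow> definable M n (\<Union>(Range R))"
    and definable_Union_Domain: "{} \<notin> Y \<Longrightarrow> definable M m (\<Union>(Domain R))"
proof -
  let ?G = "{tcat m x y | x y A B. (A, B) \<in> R \<and> x \<in> A \<and> y \<in> B}"
  have G: "definable M (m + n) ?G"
    using R(1) by (simp add: interpretable_rel_def)
  have graph: "tcat m v w \<in> ?G \<longleftrightarrow> (\<exists>A B. (A, B) \<in> R \<and> v \<in> A \<and> w \<in> B)"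
    if "v \<in> tuples M m" for v w
  proof
    assume "tcat m v w \<in> ?G"
    then obtain x y A B where *: "tcat m v w = tcat m x y" "(A, B) \<in> R" "x \<in> A" "y \<in> B"
      by blast
    then have "x \<in> tuples M m"
      using R(2) XY by auto
    with * show "\<exists>A B. (A, B) \<in> R \<and> v \<in> A \<and> w \<in> B"
      using tcat_eq_iff[OF that, of x w y] by auto
  qed blast
  have sub: "A \<in> X \<and> B \<in> Y \<and> A \<subseteq> tuples M m \<and> B \<subseteq> tuples M n" if "(A, B) \<in> R" for A B
    using that R(2) XY by (metis Sup_le_iff SigmaD1 SigmaD2 subsetD)
  show "definable M n (\<Union>(Range R))" if "{} \<notin> X"
  proof -
    have "\<Union>(Range R) = {w \<in> tuples M n. \<exists>v\<in>tuples M m. tcat m v w \<in> ?G}" (is "?L = ?R")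
    proof (intro equalityI subsetI)
      fix w assume "w \<in> ?L"
      then obtain A B where AB: "(A, B) \<in> R" "w \<in> B" by blast
      then obtain v where "v \<in> A"
        using sub \<open>{} \<notin> X\<close> by (metis ex_in_conv)
      then show "w \<in> ?R"
        using AB sub[OF AB(1)] by blast
    next
      fix w assume "w \<in> ?R"
      then obtain v where "v \<in> tuples M m" "tcat m v w \<in> ?G" by blast
      then show "w \<in> ?L" using graph by blast
    qed
    then show ?thesis
      using definable_projection_right[OF G] by simp
  qed
  show "definable M m (\<Union>(Domain R))" if "{} \<notin> Y"
  proof -
    have "\<Union>(Domain R) = {v \<in> tuples M m. \<exists>w\<in>tuples M n. tcat m v w \<in> ?G}" (is "?L = ?R")
    proof (intro equalityI subsetI)
      fix v assume "v \<in> ?L"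
      then obtain A B where AB: "(A, B) \<in> R" "v \<in> A" by blast
      then obtain w where "w \<in> B"
        using sub \<open>{} \<notin> Y\<close> by (metis ex_in_conv)
      then show "v \<in> ?R"
        using AB sub[OF AB(1)] by blast
    next
      fix v assume "v \<in> ?R"
      then obtain w where "v \<in> tuples M m" "tcat m v w \<in> ?G" by blast
      then show "v \<in> ?L" using graph by blast
    qed
    then show ?thesis
      using definable_projection_left[OF G] by simp
  qed
qed

lemma disjoint_singletons: "disjoint ((\<lambda>x. {x}) ` D)"
  by (auto simp: disjoint_def)


section \<open>Subspaces\<close>

text \<open>The traces \<open>S a \<inter> X'\<close> form a basis over the same index set
  \<open>I\<close>, and their graph is the old one cut down to \<open>I \<times> X'\<close>.\<close>

lemma interpretable_space_subtopology:
  assumes X: "interpretable_space M n X" and X': "interpretable M n X'" "X' \<subseteq> topspace X"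
  shows "interpretable_space M n (subtopology X X')"
proof -
  have iX: "interpretable M n (topspace X)"
    using X by (simp add: interpretable_space_def)
  obtain k I S where fam: "interpretable_family M k I n (topspace X) S"
    and op: "\<forall>a\<in>I. openin X (S a)"
    and base: "\<forall>U x. openin X U \<and> x \<in> U \<longrightarrow> (\<exists>a\<in>I. x \<in> S a \<and> S a \<subseteq> U)"
    using X unfolding interpretable_space_def by (elim conjE exE) (rule that)
  have I: "interpretable M k I" and S: "\<And>a. a \<in> I \<Longrightarrow> S a \<subseteq> topspace X"
    and rel: "interpretable_rel M k n {(a, x). a \<in> I \<and> x \<in> S a}"
    using fam by (auto simp: interpretable_family_def)
  have "interpretable_rel M k n ({(a, x). a \<in> I \<and> x \<in> S a} \<inter> I \<times> X')"
    using rel I iX X' S interpretable_Union_subset[OF I]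
    by (intro interpretable_rel_Int_Times[where X = I and Y = "topspace X"])
      (auto simp: interpretable_iff)
  moreover have "{(a, x). a \<in> I \<and> x \<in> S a} \<inter> I \<times> X' = {(a, x). a \<in> I \<and> x \<in> S a \<inter> X'}"
    by blast
  ultimately have "interpretable_family M k I n X' (\<lambda>a. S a \<inter> X')"
    using I by (simp add: interpretable_family_def)
  moreover have "\<forall>a\<in>I. openin (subtopology X X') (S a \<inter> X')"
    using op by (auto simp: openin_subtopology)
  moreover have "\<exists>a\<in>I. x \<in> S a \<inter> X' \<and> S a \<inter> X' \<subseteq> U"
    if U: "openin (subtopology X X') U" "x \<in> U" for U x
  proof -
    obtain T where T: "openin X T" "U = T \<inter> X'"
      using U(1) by (auto simp: openin_subtopology)
    then obtain a where "a \<in> I" "x \<in> S a" "S a \<subseteq> T"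
      using base U(2) by blast
    then show ?thesis
      using T U(2) by auto
  qed
  moreover have "topspace (subtopology X X') = X'"
    using X'(2) by (rule topspace_subtopology_subset)
  ultimately show ?thesis
    using X' unfolding interpretable_space_def by metis
qed

section \<open>Restricting an open surjection to a preimage\<close>

lemma definably_dominated_subtopology:
  assumes X: "definably_dominated M \<O> n X" and X': "interpretable M n X'" "X' \<subseteq> topspace X"
  shows "definably_dominated M \<O> n (subtopology X X')"
proof -
  have sp: "interpretable_space M n X" and "Hausdorff_space X"
    using X by (auto simp: definably_dominated_def)
  have iX: "interpretable M n (topspace X)"
    using sp by (simp add: interpretable_space_def)
  obtain k Y g where Y: "definable M k Y"
    and cont: "continuous_map (subtopology (tuples_topology M \<O> k) Y) X g"
    and op: "open_map (subtopology (tuples_topology M \<O> k) Y) X g"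
    and g: "g ` Y = topspace X"
    and rel: "interpretable_rel M k n {({y}, g y) | y. y \<in> Y}"
    using X unfolding definably_dominated_def by blast
  let ?T = "tuples_topology M \<O> k"
  let ?sing = "(\<lambda>x. {x}) ` Y"
  define Y' where "Y' = {y \<in> Y. g y \<in> X'}"
  have "interpretable_rel M k n ({({y}, g y) | y. y \<in> Y} \<inter> ?sing \<times> X')"
    using rel Y iX X' g
    by (intro interpretable_rel_Int_Times[where X = ?sing and Y = "topspace X"])
      (auto simp: interpretable_iff disjoint_singletons dest: definable_subset_tuples)
  moreover have "{({y}, g y) | y. y \<in> Y} \<inter> ?sing \<times> X' = {({y}, g y) | y. y \<in> Y'}"
    by (auto simp: Y'_def)
  ultimately have rel': "interpretable_rel M k n {({y}, g y) | y. y \<in> Y'}"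
    by simp
  \<comment> \<open>\<open>Y'\<close> is the projection of the restricted graph to its source;
    classes in \<open>X'\<close> are nonempty, so no point is lost.\<close>
  have "definable M k (\<Union>(Domain {({y}, g y) | y. y \<in> Y'}))"
    using rel' Y X' interpretable_Union_subset[OF X'(1)] definable_subset_tuples[OF Y]
    by (intro definable_Union_Domain[where X = ?sing and Y = X' and n = n])
      (auto simp: Y'_def interpretable_iff)
  moreover have "\<Union>(Domain {({y}, g y) | y. y \<in> Y'}) = Y'"
    by auto
  ultimately have "definable M k Y'"
    by simp
  moreover have Y'_sub: "subtopology ?T Y' = subtopology (subtopology ?T Y) Y'"
    by (simp add: subtopology_subtopology Y'_def Collect_conj_eq Int_absorb1 inf_commute)
  have "continuous_map (subtopology ?T Y') (subtopology X X') g"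
    unfolding Y'_sub
    by (intro continuous_map_into_subtopology continuous_map_from_subtopology cont)
      (auto simp: Y'_def)
  moreover have "open_map (subtopology ?T Y') (subtopology X X') g"
  proof -
    \<comment> \<open>The restriction rule for open maps asks for the full preimage within the
      topspace. Cutting \<open>Y'\<close> down to the topspace leaves the subspace
      unchanged.\<close>
    have "subtopology ?T Y' = subtopology (subtopology ?T Y) (topspace (subtopology ?T Y) \<inter> Y')"
      unfolding Y'_sub by (metis subtopology_restrict)
    moreover have "open_map (subtopology (subtopology ?T Y) (topspace (subtopology ?T Y) \<inter> Y'))
        (subtopology X X') g"
      using op by (rule open_map_restriction) (auto simp: Y'_def)
    ultimately show ?thesis by simp
  qed
  moreover have "g ` Y' = topspace (subtopology X X')"
  proof -
    have "g ` Y' = g ` Y \<inter> X'"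
      by (auto simp: Y'_def)
    then show ?thesis
      by (simp add: g)
  qed
  ultimately show ?thesis
    using interpretable_space_subtopology[OF sp X']
      Hausdorff_space_subtopology[OF \<open>Hausdorff_space X\<close>, of X'] rel'
    unfolding definably_dominated_def
    by (intro conjI exI[of _ k] exI[of _ Y'] exI[of _ g]) assumption+
qed

section \<open>Restricting a chart\<close>

lemma locally_definable_subtopology:
  assumes X: "locally_definable M \<O> n X" and X': "interpretable M n X'" "X' \<subseteq> topspace X"
  shows "locally_definable M \<O> n (subtopology X X')"
proof -
  have sp: "interpretable_space M n X" and "Hausdorff_space X"
    using X by (auto simp: locally_definable_def)
  have iX: "interpretable M n (topspace X)"
    using sp by (simp add: interpretable_space_def)
  have top: "topspace (subtopology X X') = X'"
    using X'(2) by (rule topspace_subtopology_subset)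
  have "\<exists>N U. openin (subtopology X X') U \<and> x \<in> U \<and> U \<subseteq> N \<and> N \<subseteq> X' \<and> interpretable M n N \<and>
      (\<exists>k D f. definable M k D \<and>
         homeomorphic_map (subtopology (subtopology X X') N)
           (subtopology (tuples_topology M \<O> k) D) f \<and>
         interpretable_rel M n k {(y, {f y}) | y. y \<in> N})" if "x \<in> X'" for x
  proof -
    obtain N U k D f where U: "openin X U" "x \<in> U" "U \<subseteq> N" and N: "N \<subseteq> topspace X"
      and iN: "interpretable M n N" and D: "definable M k D"
      and hom: "homeomorphic_map (subtopology X N) (subtopology (tuples_topology M \<O> k) D) f"
      and rel: "interpretable_rel M n k {(y, {f y}) | y. y \<in> N}"
      using X X' \<open>x \<in> X'\<close> unfolding locally_definable_def by blast
    let ?T = "tuples_topology M \<O> k"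
    let ?sing = "(\<lambda>x. {x}) ` tuples M k"
    define N' where "N' = N \<inter> X'"
    define D' where "D' = f ` N'"
    have iN': "interpretable M n N'"
      unfolding N'_def using iN X' N iX
      by (intro interpretable_Int[where X = "topspace X"]) (auto simp: interpretable_iff)
    \<comment> \<open>A chart is onto the topspace of the subspace on \<open>D\<close>, which lies
      inside \<open>D\<close>; hence its values are \<open>k\<close>-tuples.\<close>
    have fN: "f ` N = topspace (subtopology ?T D)"
      using homeomorphic_imp_surjective_map[OF hom] unfolding topspace_subtopology_subset[OF N] .
    then have D'D: "D' \<subseteq> D" "D' \<subseteq> tuples M k" and fNt: "f ` N \<subseteq> tuples M k"
      using definable_subset_tuples[OF D] by (auto simp: D'_def N'_def)
    \<comment> \<open>Only the source of the graph is cut down; the target side allows the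
      singletons of all \<open>k\<close>-tuples.\<close>
    have "interpretable_rel M n k ({(y, {f y}) | y. y \<in> N} \<inter> N' \<times> ?sing)"
      using rel fNt iN iN' definable_tuples[OF D, of k]
      by (intro interpretable_rel_Int_Times[where X = N and Y = ?sing])
        (auto simp: interpretable_iff disjoint_singletons N'_def dest: definable_subset_tuples)
    moreover have "{(y, {f y}) | y. y \<in> N} \<inter> N' \<times> ?sing = {(y, {f y}) | y. y \<in> N'}"
      using fNt by (auto simp: N'_def)
    ultimately have rel': "interpretable_rel M n k {(y, {f y}) | y. y \<in> N'}"
      by simp
    \<comment> \<open>The image \<open>D'\<close> is the projection of the restricted graph to its
      target, the classes in \<open>N'\<close> being nonempty.\<close>
    have "definable M k (\<Union>(Range {(y, {f y}) | y. y \<in> N'}))"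
      using rel' iN' D'D interpretable_Union_subset[OF iN']
      by (intro definable_Union_Range[where X = N' and Y = ?sing and m = n])
        (auto simp: D'_def interpretable_iff)
    moreover have "\<Union>(Range {(y, {f y}) | y. y \<in> N'}) = D'"
      by (auto simp: D'_def)
    ultimately have "definable M k D'"
      by simp
    moreover have "homeomorphic_map (subtopology (subtopology X X') N') (subtopology ?T D') f"
    proof -
      have "homeomorphic_map (subtopology (subtopology X N) N')
          (subtopology (subtopology ?T D) D') f"
        using hom
      proof (rule homeomorphic_map_subtopologies)
        show "f ` (topspace (subtopology X N) \<inter> N') = topspace (subtopology ?T D) \<inter> D'"
          using fN N by (auto simp: D'_def N'_def)
      qed
      moreover have "N \<inter> N' = N'" "X' \<inter> N' = N'" "D \<inter> D' = D'"
        using D'D by (auto simp: N'_def)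
      ultimately show ?thesis
        by (simp add: subtopology_subtopology)
    qed
    \<comment> \<open>The trace of \<open>U\<close> is the open set witnessing that
      \<open>N'\<close> is a neighbourhood of \<open>x\<close> in the subspace.\<close>
    moreover have "openin (subtopology X X') (U \<inter> X')"
      using U by (auto simp: openin_subtopology)
    moreover have "x \<in> U \<inter> X'" "U \<inter> X' \<subseteq> N'" "N' \<subseteq> X'"
      using U that by (auto simp: N'_def)
    ultimately show ?thesis
      using iN' rel' by blast
  qed
  then show ?thesis
    using interpretable_space_subtopology[OF sp X'] \<open>Hausdorff_space X\<close>
    unfolding locally_definable_def top by (simp add: Hausdorff_space_subtopology)
qed

theorem proposition4p13:
  fixes p :: nat and M :: "('a, 'm) ring_scheme" and \<kappa> :: "'k rel" and \<O> :: "'a set"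
  assumes "prime p"
    and "monster_model p M \<kappa>"
    and "p_valuation_ring p M \<O>"
  shows "closed_under_subspaces M (locally_definable M \<O>)
    \<and> closed_under_subspaces M (definably_dominated M \<O>)
    \<and> closed_under_subspaces M (admissible M \<O>)"
  unfolding closed_under_subspaces_def admissible_def
  using locally_definable_subtopology definably_dominated_subtopology by blast

end
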